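(* Let $\alpha\in\mathbb{R}$, let $f\in D_\alpha$ with $f(0)\neq 0$, let $p_n$ be the optimal approximant of order $n$ to $1/f$ in $D_\alpha$, and let $(\varphi_k)_{k\ge 0}$ be the orthogonal polynomials for the weighted space $D_{\alpha,f}$. The following are equivalent: (1) $f$ is cyclic in $D_\alpha$; (2) $p_n(0)$ converges to $1/f(0)$ as $n\to\infty$; (3) $\sum_{k=0}^\infty|\varphi_k(0)|^2=1/|f(0)|^2$.
   Context: $\mathbb{D}=\{z\in\mathbb{C}:|z|<1\}$. For $\alpha\in\mathbb{R}$, the Dirichlet-type space $D_\alpha$ consists of all analytic functions $f=\sum_{k\ge 0}a_kz^k$ on $\mathbb{D}$ with $\|f\|_\alpha^2=\sum_{k=0}^\infty (k+1)^\alpha|a_k|^2<\infty$; it is a Hilbert space with inner product $\langle f,g\rangle_\alpha=\sum_{k=0}^\infty (k+1)^\alpha a_k\overline{b_k}$ for $g=\sum_{k\ge0} b_kz^k$. Let $\mathcal{P}_n$ be the space of complex polynomials of degree at most $n$. The optimal approximant of order $n$ to $1/f$ (in $D_\alpha$) is the unique $p_n\in\mathcal{P}_n$ minimizing $\|pf-1\|_\alpha$ over all $p\in\mathcal{P}_n$. A function $f\in D_\alpha$ is cyclic in $D_\alpha$ if the closed linear span in $D_\alpha$ of $\{z^kf:k=0,1,2,\ldots\}$ equals $D_\alpha$. The weighted space $D_{\alpha,f}$ has inner product $\langle\varphi,\psi\rangle_{\alpha,f}=\langle\varphi f,\psi f\rangle_\alpha$, and its orthogonal polynomials $(\varphi_k)_{k\ge0}$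 are the unique polynomials such that $\varphi_k$ has degree exactly $k$ and positive leading coefficient and $\langle\varphi_kf,\varphi_jf\rangle_\alpha=\delta_{k,j}$ for all $k,j\ge 0$. *)

theory Defs
  imports "HOL-Complex_Analysis.Complex_Analysis" "HOL-Library.Function_Algebras"
begin

text \<open>
  Analytic functions on the unit disc are represented by total functions on the complex numbers;
  only their restriction to \<^term>\<open>ball (0::complex) 1\<close> matters. Two functions that agree there
  have the same Taylor coefficients, hence distance 0 in \<open>dirichlet_norm\<close>, and
  \<open>dirichlet_space\<close> and \<open>dirichlet_closed_span\<close> contain either both or neither of them.
\<close>

definition taylor_coeff :: "(complex \<Rightarrow> complex) \<Rightarrow> nat \<Rightarrow> complex" where
  "taylor_coeff f k = fps_nth (fps_expansion f 0) k"

definition dirichlet_space :: "real \<Rightarrow> (complex \<Rightarrow> complex) set" where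
  "dirichlet_space \<alpha> = {f. f holomorphic_on ball 0 1 \<and>
     summable (\<lambda>k. real (k + 1) powr \<alpha> * (cmod (taylor_coeff f k))\<^sup>2)}"

definition dirichlet_norm :: "real \<Rightarrow> (complex \<Rightarrow> complex) \<Rightarrow> real" where
  "dirichlet_norm \<alpha> f = sqrt (\<Sum>k. real (k + 1) powr \<alpha> * (cmod (taylor_coeff f k))\<^sup>2)"

definition dirichlet_inner :: "real \<Rightarrow> (complex \<Rightarrow> complex) \<Rightarrow> (complex \<Rightarrow> complex) \<Rightarrow> complex" where
  "dirichlet_inner \<alpha> f g =
     (\<Sum>k. of_real (real (k + 1) powr \<alpha>) * taylor_coeff f k * cnj (taylor_coeff g k))"

definition weighted_inner ::
  "real \<Rightarrow> (complex \<Rightarrow> complex) \<Rightarrow> (complex \<Rightarrow> complex) \<Rightarrow> (complex \<Rightarrow> complex) \<Rightarrow> complex" where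
  "weighted_inner \<alpha> f \<phi> \<psi> = dirichlet_inner \<alpha> (\<lambda>z. \<phi> z * f z) (\<lambda>z. \<psi> z * f z)"

definition is_optimal_approximant ::
  "real \<Rightarrow> (complex \<Rightarrow> complex) \<Rightarrow> nat \<Rightarrow> complex poly \<Rightarrow> bool" where
  "is_optimal_approximant \<alpha> f n p \<longleftrightarrow> degree p \<le> n \<and>
     (\<forall>q. degree q \<le> n \<longrightarrow>
        dirichlet_norm \<alpha> (\<lambda>z. poly p z * f z - 1) \<le> dirichlet_norm \<alpha> (\<lambda>z. poly q z * f z - 1))"

definition fun_scale :: "complex \<Rightarrow> (complex \<Rightarrow> complex) \<Rightarrow> complex \<Rightarrow> complex" where
  "fun_scale c g = (\<lambda>z. c * g z)"

global_interpretation cfun: vector_space fun_scale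
  by unfold_locales (auto simp: fun_scale_def fun_eq_iff algebra_simps)

text \<open>Meaningful for subsets of the Dirichlet-type space, which is the only case used.\<close>

definition dirichlet_closed_span :: "real \<Rightarrow> (complex \<Rightarrow> complex) set \<Rightarrow> (complex \<Rightarrow> complex) set" where
  "dirichlet_closed_span \<alpha> S = {g \<in> dirichlet_space \<alpha>.
     \<forall>\<epsilon>>0. \<exists>h\<in>cfun.span S. dirichlet_norm \<alpha> (\<lambda>z. g z - h z) < \<epsilon>}"

definition cyclic :: "real \<Rightarrow> (complex \<Rightarrow> complex) \<Rightarrow> bool" where
  "cyclic \<alpha> f \<longleftrightarrow> f \<in> dirichlet_space \<alpha> \<and>
     dirichlet_closed_span \<alpha> (range (\<lambda>k z. z ^ k * f z)) = dirichlet_space \<alpha>"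

definition is_orthogonal_polynomials ::
  "real \<Rightarrow> (complex \<Rightarrow> complex) \<Rightarrow> (nat \<Rightarrow> complex poly) \<Rightarrow> bool" where
  "is_orthogonal_polynomials \<alpha> f \<phi> \<longleftrightarrow>
     (\<forall>k. degree (\<phi> k) = k \<and> lead_coeff (\<phi> k) \<in> \<real> \<and> Re (lead_coeff (\<phi> k)) > 0) \<and>
     (\<forall>k j. weighted_inner \<alpha> f (poly (\<phi> k)) (poly (\<phi> j)) = (if k = j then 1 else 0))"

end

theory Submission
  imports Defs
begin

text \<open>
  Put \<open>c\<^sub>k = \<phi>\<^sub>k(0) f(0) = \<langle>\<phi>\<^sub>k f, 1\<rangle>\<close>. For \<open>q = \<Sum>\<^sub>k\<^sub>\<le>\<^sub>n b\<^sub>k \<phi>\<^sub>k\<close> orthonormality gives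
  \<open>\<parallel>q f - 1\<parallel>\<^sup>2 = 1 - \<Sum>\<^sub>k\<^sub>\<le>\<^sub>n |c\<^sub>k|\<^sup>2 + \<Sum>\<^sub>k\<^sub>\<le>\<^sub>n |b\<^sub>k - cnj c\<^sub>k|\<^sup>2\<close>, so the optimal approximant has
  \<open>b\<^sub>k = cnj c\<^sub>k\<close>. Hence \<open>p\<^sub>n(0) f(0) = |f(0)|\<^sup>2 \<Sum>\<^sub>k\<^sub>\<le>\<^sub>n |\<phi>\<^sub>k(0)|\<^sup>2 = 1 - \<parallel>p\<^sub>n f - 1\<parallel>\<^sup>2\<close>, which
  makes (2) and (3) equivalent to each other and to \<open>\<parallel>p\<^sub>n f - 1\<parallel> \<rightarrow> 0\<close>. The latter says that
  \<open>1\<close> lies in the closed span of the \<open>z\<^sup>k f\<close>; since multiplication by a polynomial is bounded and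
  polynomials are dense, this is cyclicity.
\<close>

subsection \<open>Taylor coefficients\<close>

text \<open>Power series expansions are unique, so coefficient identities reduce to closure rules of
  \<open>has_fps_expansion\<close>.\<close>

lemma taylor_coeff_eqI:
  assumes "f has_fps_expansion F"
  shows "taylor_coeff f k = fps_nth F k"
  using fps_expansion_eqI[OF assms] by (simp add: taylor_coeff_def)

lemma holomorphic_has_fps_expansion:
  assumes "f holomorphic_on ball 0 1"
  shows "f has_fps_expansion fps_expansion f 0"
  by (rule has_fps_expansion_fps_expansion[OF _ _ assms]) auto

lemma taylor_coeff_add:
  assumes "f holomorphic_on ball 0 1" "g holomorphic_on ball 0 1"
  shows "taylor_coeff (\<lambda>z. f z + g z) k = taylor_coeff f k + taylor_coeff g k"
  using taylor_coeff_eqI[OF has_fps_expansion_add[OF assms[THEN holomorphic_has_fps_expansion]]]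
  by (simp add: taylor_coeff_def)

lemma taylor_coeff_cmult:
  assumes "f holomorphic_on ball 0 1"
  shows "taylor_coeff (\<lambda>z. c * f z) k = c * taylor_coeff f k"
  using taylor_coeff_eqI[OF has_fps_expansion_cmult_left[OF holomorphic_has_fps_expansion[OF assms]]]
  by (simp add: taylor_coeff_def)

lemma taylor_coeff_shift:
  assumes "f holomorphic_on ball 0 1"
  shows "taylor_coeff (\<lambda>z. z * f z) k = (if k = 0 then 0 else taylor_coeff f (k - 1))"
proof -
  have "(\<lambda>z. z * f z) has_fps_expansion fps_X * fps_expansion f 0"
    by (intro has_fps_expansion_mult has_fps_expansion_fps_X holomorphic_has_fps_expansion assms)
  from taylor_coeff_eqI[OF this] show ?thesis
    by (simp add: taylor_coeff_def)
qed

lemma taylor_coeff_poly: "taylor_coeff (poly q) k = coeff q k"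
proof -
  have "poly q has_fps_expansion fps_of_poly q"
    by (simp add: has_fps_expansion_def)
  from taylor_coeff_eqI[OF this] show ?thesis by simp
qed

lemma taylor_coeff_0: "taylor_coeff f 0 = f 0"
  by (simp add: taylor_coeff_def fps_expansion_def)

subsection \<open>The Dirichlet-type spaces\<close>

lemma dirichlet_spaceD:
  assumes "f \<in> dirichlet_space \<alpha>"
  shows "f holomorphic_on ball 0 1"
    and "summable (\<lambda>k. real (k + 1) powr \<alpha> * (cmod (taylor_coeff f k))\<^sup>2)"
  using assms by (auto simp: dirichlet_space_def)

text \<open>The estimates below work with squared norms. Membership makes the series converge, hence
  its sum nonnegative, so that squaring undoes the root.\<close>

lemma dirichlet_norm_sq:
  "f \<in> dirichlet_space \<alpha> \<Longrightarrow>
     (dirichlet_norm \<alpha> f)\<^sup>2 = (\<Sum>k. real (k + 1) powr \<alpha> * (cmod (taylor_coeff f k))\<^sup>2)"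
  unfolding dirichlet_norm_def
  by (rule real_sqrt_pow2, rule suminf_nonneg) (auto simp: dirichlet_space_def)

lemma dirichlet_norm_nonneg: "f \<in> dirichlet_space \<alpha> \<Longrightarrow> 0 \<le> dirichlet_norm \<alpha> f"
  unfolding dirichlet_norm_def
  by (rule real_sqrt_ge_zero, rule suminf_nonneg) (auto simp: dirichlet_space_def)

text \<open>A squared substitute for the triangle inequality, from
  \<open>(cmod a - cmod b)\<^sup>2 \<ge> 0\<close>. It can be summed against the weights term by
  term, and the factor 2 is harmless where only smallness matters.\<close>

lemma cmod_add_sq_le: "(cmod (a + b))\<^sup>2 \<le> 2 * (cmod a)\<^sup>2 + 2 * (cmod b)\<^sup>2"
proof -
  have "(cmod (a + b))\<^sup>2 \<le> (cmod a + cmod b)\<^sup>2"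
    by (intro power_mono norm_triangle_ineq) auto
  also have "\<dots> \<le> 2 * (cmod a)\<^sup>2 + 2 * (cmod b)\<^sup>2"
    using zero_le_power2[of "cmod a - cmod b"] unfolding power2_sum power2_diff by linarith
  finally show ?thesis .
qed

lemma dirichlet_space_add:
  assumes "f \<in> dirichlet_space \<alpha>" "g \<in> dirichlet_space \<alpha>"
  shows "(\<lambda>z. f z + g z) \<in> dirichlet_space \<alpha>"
    and "(dirichlet_norm \<alpha> (\<lambda>z. f z + g z))\<^sup>2 \<le> 2 * (dirichlet_norm \<alpha> f)\<^sup>2 + 2 * (dirichlet_norm \<alpha> g)\<^sup>2"
proof -
  note f = dirichlet_spaceD[OF assms(1)] and g = dirichlet_spaceD[OF assms(2)]
  let ?w = "\<lambda>k. real (k + 1) powr \<alpha>"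
  have le: "?w k * (cmod (taylor_coeff (\<lambda>z. f z + g z) k))\<^sup>2
      \<le> 2 * (?w k * (cmod (taylor_coeff f k))\<^sup>2) + 2 * (?w k * (cmod (taylor_coeff g k))\<^sup>2)" for k
    using mult_left_mono[OF cmod_add_sq_le[of "taylor_coeff f k" "taylor_coeff g k"], of "?w k"]
    by (simp add: taylor_coeff_add f g algebra_simps)
  have sum: "summable (\<lambda>k. 2 * (?w k * (cmod (taylor_coeff f k))\<^sup>2) + 2 * (?w k * (cmod (taylor_coeff g k))\<^sup>2))"
    by (intro summable_add summable_mult f g)
  have sum': "summable (\<lambda>k. ?w k * (cmod (taylor_coeff (\<lambda>z. f z + g z) k))\<^sup>2)"
    by (rule summable_comparison_test'[OF sum, of 0]) (use le in simp)
  show *: "(\<lambda>z. f z + g z) \<in> dirichlet_space \<alpha>"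
    using sum' f(1) g(1) by (auto simp: dirichlet_space_def intro!: holomorphic_intros)
  show "(dirichlet_norm \<alpha> (\<lambda>z. f z + g z))\<^sup>2 \<le> 2 * (dirichlet_norm \<alpha> f)\<^sup>2 + 2 * (dirichlet_norm \<alpha> g)\<^sup>2"
    using suminf_le[OF le sum' sum]
    unfolding dirichlet_norm_sq[OF *] dirichlet_norm_sq[OF assms(1)] dirichlet_norm_sq[OF assms(2)]
      suminf_add[OF summable_mult[OF f(2)] summable_mult[OF g(2)], symmetric]
      suminf_mult[OF f(2)] suminf_mult[OF g(2)] .
qed

lemma dirichlet_space_cmult:
  assumes "f \<in> dirichlet_space \<alpha>"
  shows "(\<lambda>z. c * f z) \<in> dirichlet_space \<alpha>"
    and "(dirichlet_norm \<alpha> (\<lambda>z. c * f z))\<^sup>2 = (cmod c)\<^sup>2 * (dirichlet_norm \<alpha> f)\<^sup>2"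
proof -
  note f = dirichlet_spaceD[OF assms(1)]
  have eq: "real (k + 1) powr \<alpha> * (cmod (taylor_coeff (\<lambda>z. c * f z) k))\<^sup>2 =
      (cmod c)\<^sup>2 * (real (k + 1) powr \<alpha> * (cmod (taylor_coeff f k))\<^sup>2)" for k
    by (simp add: taylor_coeff_cmult f norm_mult power_mult_distrib)
  show *: "(\<lambda>z. c * f z) \<in> dirichlet_space \<alpha>"
    using f unfolding dirichlet_space_def mem_Collect_eq eq
    by (auto intro!: holomorphic_intros summable_mult)
  show "(dirichlet_norm \<alpha> (\<lambda>z. c * f z))\<^sup>2 = (cmod c)\<^sup>2 * (dirichlet_norm \<alpha> f)\<^sup>2"
    unfolding dirichlet_norm_sq[OF *] dirichlet_norm_sq[OF assms] eq
    by (rule suminf_mult[OF f(2)])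
qed

lemma dirichlet_space_diff:
  assumes "f \<in> dirichlet_space \<alpha>" "g \<in> dirichlet_space \<alpha>"
  shows "(\<lambda>z. f z - g z) \<in> dirichlet_space \<alpha>"
  using dirichlet_space_add(1)[OF assms(1) dirichlet_space_cmult(1)[OF assms(2), of "-1"]] by simp

lemma dirichlet_norm_minus_commute:
  assumes "f \<in> dirichlet_space \<alpha>" "g \<in> dirichlet_space \<alpha>"
  shows "dirichlet_norm \<alpha> (\<lambda>z. f z - g z) = dirichlet_norm \<alpha> (\<lambda>z. g z - f z)"
  using dirichlet_space_cmult(2)[OF dirichlet_space_diff[OF assms], of "-1"]
    dirichlet_norm_nonneg[OF dirichlet_space_diff[OF assms]]
    dirichlet_norm_nonneg[OF dirichlet_space_diff[OF assms(2,1)]]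
  by (auto simp: power2_eq_iff)

lemma dirichlet_space_poly: "poly q \<in> dirichlet_space \<alpha>"
proof -
  have "summable (\<lambda>k. real (k + 1) powr \<alpha> * (cmod (coeff q k))\<^sup>2)"
    by (rule summable_finite[of "{..degree q}"]) (auto simp: coeff_eq_0)
  then show ?thesis
    by (auto simp: dirichlet_space_def taylor_coeff_poly intro!: holomorphic_intros)
qed

lemma dirichlet_space_one: "(\<lambda>z. 1) \<in> dirichlet_space \<alpha>"
  using dirichlet_space_poly[of 1 \<alpha>] by (simp add: poly_1[abs_def])

lemma taylor_coeff_one: "taylor_coeff (\<lambda>z. 1) k = (if k = 0 then 1 else 0)"
  using taylor_coeff_poly[of 1 k] by (simp add: poly_1[abs_def] coeff_eq_0)

lemma dirichlet_norm_one: "dirichlet_norm \<alpha> (\<lambda>z. 1) = 1"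
proof -
  have "(\<lambda>k. real (k + 1) powr \<alpha> * (cmod (taylor_coeff (\<lambda>z. 1) k))\<^sup>2) = (\<lambda>k. if k = 0 then 1 else 0)"
    by (auto simp: taylor_coeff_one)
  then show ?thesis
    unfolding dirichlet_norm_def using sums_unique[OF sums_single[of 0 "\<lambda>_. 1 :: real"]] by simp
qed

text \<open>Multiplication by z moves the k-th coefficient from weight
  \<open>(k + 1) powr \<alpha>\<close> to weight \<open>(k + 2) powr \<alpha>\<close>. The ratio of
  the weights is at most \<open>2 powr \<alpha>\<close> for \<alpha> \<ge> 0, because k + 2 \<le> 2
  (k + 1), and at most 1 for negative \<alpha>.\<close>

lemma dirichlet_space_shift:
  assumes "f \<in> dirichlet_space \<alpha>"
  shows "(\<lambda>z. z * f z) \<in> dirichlet_space \<alpha>"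
    and "(dirichlet_norm \<alpha> (\<lambda>z. z * f z))\<^sup>2 \<le> max 1 (2 powr \<alpha>) * (dirichlet_norm \<alpha> f)\<^sup>2"
proof -
  note f = dirichlet_spaceD[OF assms(1)]
  let ?M = "max 1 (2 powr \<alpha>)"
  let ?u = "\<lambda>k. real (k + 1) powr \<alpha> * (cmod (taylor_coeff (\<lambda>z. z * f z) k))\<^sup>2"
  have w: "real (Suc k + 1) powr \<alpha> \<le> ?M * real (k + 1) powr \<alpha>" for k
  proof (cases "\<alpha> \<ge> 0")
    case True
    have "real (Suc k + 1) powr \<alpha> \<le> (2 * real (k + 1)) powr \<alpha>"
      by (rule powr_mono2) (use True in auto)
    also have "\<dots> = 2 powr \<alpha> * real (k + 1) powr \<alpha>"
      by (rule powr_mult)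
    also have "\<dots> \<le> ?M * real (k + 1) powr \<alpha>"
      by (rule mult_right_mono) auto
    finally show ?thesis .
  next
    case False
    then have "real (Suc k + 1) powr \<alpha> \<le> 1 * real (k + 1) powr \<alpha>"
      using powr_mono2'[of \<alpha> "real (k + 1)" "real (Suc k + 1)"] by simp
    also have "\<dots> \<le> ?M * real (k + 1) powr \<alpha>"
      by (rule mult_right_mono) auto
    finally show ?thesis .
  qed
  have le: "?u (Suc k) \<le> ?M * (real (k + 1) powr \<alpha> * (cmod (taylor_coeff f k))\<^sup>2)" for k
    using mult_right_mono[OF w[of k], of "(cmod (taylor_coeff f k))\<^sup>2"]
    by (simp add: taylor_coeff_shift f mult.assoc)
  have u0: "?u 0 = 0"
    by (simp add: taylor_coeff_shift f)
  have sum: "summable (\<lambda>k. ?M * (real (k + 1) powr \<alpha> * (cmod (taylor_coeff f k))\<^sup>2))"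
    by (intro summable_mult f)
  have sum': "summable (\<lambda>k. ?u (Suc k))"
    by (rule summable_comparison_test'[OF sum, of 0]) (use le in simp)
  then have sum'': "summable ?u"
    by (rule iffD1[OF summable_Suc_iff])
  show *: "(\<lambda>z. z * f z) \<in> dirichlet_space \<alpha>"
    using sum'' f(1) by (auto simp: dirichlet_space_def intro!: holomorphic_intros)
  have "(\<Sum>k. ?u k) = (\<Sum>k. ?u (Suc k))"
    using suminf_split_head[OF sum''] u0 by linarith
  also have "\<dots> \<le> (\<Sum>k. ?M * (real (k + 1) powr \<alpha> * (cmod (taylor_coeff f k))\<^sup>2))"
    by (rule suminf_le[OF le sum' sum])
  also have "\<dots> = ?M * (\<Sum>k. real (k + 1) powr \<alpha> * (cmod (taylor_coeff f k))\<^sup>2)"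
    by (rule suminf_mult[OF f(2)])
  finally show "(dirichlet_norm \<alpha> (\<lambda>z. z * f z))\<^sup>2 \<le> ?M * (dirichlet_norm \<alpha> f)\<^sup>2"
    unfolding dirichlet_norm_sq[OF *] dirichlet_norm_sq[OF assms] .
qed

section \<open>Multiplication by polynomials and density of polynomials\<close>

lemma dirichlet_space_poly_mult:
  assumes "f \<in> dirichlet_space \<alpha>"
  shows "(\<lambda>z. poly q z * f z) \<in> dirichlet_space \<alpha>"
proof (induction q)
  case 0
  show ?case
    using dirichlet_space_cmult(1)[OF assms, of 0] by simp
next
  case (pCons a q)
  from dirichlet_space_add(1)[OF dirichlet_space_cmult(1)[OF assms, of a]
      dirichlet_space_shift(1)[OF pCons.IH]]
  show ?case by (simp add: algebra_simps)
qed

text \<open>Horner induction: \<open>(a + z q) f = a f + z (q f)\<close> combines the scalar and the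
  shift bounds. \<open>C\<close> is kept strictly positive, even for the zero polynomial, because
  the cyclicity argument divides by it.\<close>

lemma poly_multiplication_bounded:
  obtains C where "C > 0" "\<And>f. f \<in> dirichlet_space \<alpha> \<Longrightarrow>
    (dirichlet_norm \<alpha> (\<lambda>z. poly q z * f z))\<^sup>2 \<le> C * (dirichlet_norm \<alpha> f)\<^sup>2"
proof -
  have "\<exists>C>0. \<forall>f\<in>dirichlet_space \<alpha>.
    (dirichlet_norm \<alpha> (\<lambda>z. poly q z * f z))\<^sup>2 \<le> C * (dirichlet_norm \<alpha> f)\<^sup>2"
  proof (induction q)
    case 0
    have "(dirichlet_norm \<alpha> (\<lambda>z. poly 0 z * f z))\<^sup>2 \<le> 1 * (dirichlet_norm \<alpha> f)\<^sup>2"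
      if "f \<in> dirichlet_space \<alpha>" for f
      using dirichlet_space_cmult(2)[OF that, of 0] by simp
    then show ?case by (intro exI[of _ 1]) auto
  next
    case (pCons a q)
    then obtain C where C: "C > 0" "\<And>f. f \<in> dirichlet_space \<alpha> \<Longrightarrow>
        (dirichlet_norm \<alpha> (\<lambda>z. poly q z * f z))\<^sup>2 \<le> C * (dirichlet_norm \<alpha> f)\<^sup>2"
      by auto
    define M where "M = max 1 (2 powr \<alpha>)"
    have M: "M > 0" by (simp add: M_def)
    have "(dirichlet_norm \<alpha> (\<lambda>z. poly (pCons a q) z * f z))\<^sup>2
        \<le> (2 * (cmod a)\<^sup>2 + 2 * M * C) * (dirichlet_norm \<alpha> f)\<^sup>2"
      if f: "f \<in> dirichlet_space \<alpha>" for f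
    proof -
      note qf = dirichlet_space_poly_mult[OF f, of q]
      have "(dirichlet_norm \<alpha> (\<lambda>z. poly (pCons a q) z * f z))\<^sup>2 =
          (dirichlet_norm \<alpha> (\<lambda>z. a * f z + z * (poly q z * f z)))\<^sup>2"
        by (simp add: algebra_simps)
      also have "\<dots> \<le> 2 * (dirichlet_norm \<alpha> (\<lambda>z. a * f z))\<^sup>2
          + 2 * (dirichlet_norm \<alpha> (\<lambda>z. z * (poly q z * f z)))\<^sup>2"
        by (intro dirichlet_space_add dirichlet_space_cmult dirichlet_space_shift qf f)
      also have "\<dots> \<le> 2 * ((cmod a)\<^sup>2 * (dirichlet_norm \<alpha> f)\<^sup>2)
          + 2 * (M * (C * (dirichlet_norm \<alpha> f)\<^sup>2))"
        using dirichlet_space_shift(2)[OF qf, folded M_def] mult_left_mono[OF C(2)[OF f], of M] M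
        unfolding dirichlet_space_cmult(2)[OF f] by linarith
      finally show ?thesis by (simp add: algebra_simps)
    qed
    moreover have "2 * (cmod a)\<^sup>2 + 2 * M * C > 0"
      using C(1) M by (intro add_nonneg_pos) auto
    ultimately show ?case by blast
  qed
  then show ?thesis using that by blast
qed

text \<open>Taylor polynomials suffice: the squared distance to the one with N terms is a tail of
  the convergent series for the squared norm.\<close>

lemma polynomials_dense:
  assumes f: "f \<in> dirichlet_space \<alpha>" and "\<epsilon> > 0"
  obtains q where "(dirichlet_norm \<alpha> (\<lambda>z. f z - poly q z))\<^sup>2 < \<epsilon>"
proof -
  note f' = dirichlet_spaceD[OF f]
  let ?u = "\<lambda>k. real (k + 1) powr \<alpha> * (cmod (taylor_coeff f k))\<^sup>2"
  obtain N where N: "norm (\<Sum>i. ?u (i + N)) < \<epsilon>"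
    using suminf_exist_split[OF \<open>\<epsilon> > 0\<close> f'(2)] by blast
  define q where "q = (\<Sum>i<N. monom (taylor_coeff f i) i)"
  have q: "coeff q k = (if k < N then taylor_coeff f k else 0)" for k
    by (simp add: q_def coeff_sum coeff_monom)
  let ?g = "\<lambda>z. f z - poly q z"
  have g: "?g \<in> dirichlet_space \<alpha>"
    by (rule dirichlet_space_diff[OF f dirichlet_space_poly])
  \<comment> \<open>The difference is treated as a sum with \<open>poly (- q)\<close>, so that
    additivity of the coefficients applies.\<close>
  have "taylor_coeff (\<lambda>z. f z + poly (- q) z) k = taylor_coeff f k + coeff (- q) k" for k
    unfolding taylor_coeff_poly[of "- q", symmetric]
    by (rule taylor_coeff_add[OF f'(1) dirichlet_spaceD(1)[OF dirichlet_space_poly]])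
  then have tg: "taylor_coeff ?g k = (if k < N then 0 else taylor_coeff f k)" for k
    by (simp add: q)
  have "(dirichlet_norm \<alpha> ?g)\<^sup>2 = (\<Sum>k. if k < N then 0 else ?u k)"
    unfolding dirichlet_norm_sq[OF g] by (rule arg_cong[of _ _ suminf]) (auto simp: tg)
  also have "\<dots> = (\<Sum>i. ?u (i + N))"
  proof -
    have "summable (\<lambda>k. if k < N then 0 else ?u k)"
      using dirichlet_spaceD(2)[OF g] by (rule back_subst[of summable]) (auto simp: tg)
    from suminf_split_initial_segment[OF this, of N] show ?thesis by simp
  qed
  finally have "(dirichlet_norm \<alpha> ?g)\<^sup>2 < \<epsilon>" using N by simp
  then show ?thesis by (rule that)
qed

subsection \<open>The inner product\<close>

text \<open>The weighted products are dominated by the sum of the two norm series, since a product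
  of two moduli is at most the sum of their squares.\<close>

lemma dirichlet_inner_summable:
  assumes "f \<in> dirichlet_space \<alpha>" "g \<in> dirichlet_space \<alpha>"
  shows "summable (\<lambda>k. of_real (real (k + 1) powr \<alpha>) * taylor_coeff f k * cnj (taylor_coeff g k))"
proof (rule summable_comparison_test')
  show "summable (\<lambda>k. real (k + 1) powr \<alpha> * (cmod (taylor_coeff f k))\<^sup>2
      + real (k + 1) powr \<alpha> * (cmod (taylor_coeff g k))\<^sup>2)"
    by (intro summable_add dirichlet_spaceD assms)
  fix k :: nat
  have "cmod a * cmod b \<le> (cmod a)\<^sup>2 + (cmod b)\<^sup>2" for a b
    using zero_le_power2[of "cmod a - cmod b"] mult_nonneg_nonneg[of "cmod a" "cmod b"]
    unfolding power2_diff by (simp del: mult_nonneg_nonneg)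
  from mult_left_mono[OF this, of "real (k + 1) powr \<alpha>" "taylor_coeff f k" "taylor_coeff g k"]
  show "norm (of_real (real (k + 1) powr \<alpha>) * taylor_coeff f k * cnj (taylor_coeff g k))
      \<le> real (k + 1) powr \<alpha> * (cmod (taylor_coeff f k))\<^sup>2
      + real (k + 1) powr \<alpha> * (cmod (taylor_coeff g k))\<^sup>2"
    by (simp add: norm_mult algebra_simps)
qed

lemma dirichlet_inner_add_left:
  assumes "f \<in> dirichlet_space \<alpha>" "g \<in> dirichlet_space \<alpha>" "h \<in> dirichlet_space \<alpha>"
  shows "dirichlet_inner \<alpha> (\<lambda>z. f z + g z) h = dirichlet_inner \<alpha> f h + dirichlet_inner \<alpha> g h"
  unfolding dirichlet_inner_def
    suminf_add[OF dirichlet_inner_summable[OF assms(1,3)] dirichlet_inner_summable[OF assms(2,3)]]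
  by (rule arg_cong[of _ _ suminf])
    (simp add: fun_eq_iff taylor_coeff_add dirichlet_spaceD[OF assms(1)]
      dirichlet_spaceD[OF assms(2)] algebra_simps)

lemma dirichlet_inner_cmult_left:
  assumes "f \<in> dirichlet_space \<alpha>" "h \<in> dirichlet_space \<alpha>"
  shows "dirichlet_inner \<alpha> (\<lambda>z. c * f z) h = c * dirichlet_inner \<alpha> f h"
  unfolding dirichlet_inner_def suminf_mult[OF dirichlet_inner_summable[OF assms], symmetric]
  by (rule arg_cong[of _ _ suminf])
    (simp add: fun_eq_iff taylor_coeff_cmult dirichlet_spaceD[OF assms(1)] algebra_simps)

text \<open>Carries the linearity rules for the first argument over to conjugate linearity in the
  second.\<close>

lemma dirichlet_inner_cnj:
  assumes "f \<in> dirichlet_space \<alpha>" "g \<in> dirichlet_space \<alpha>"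
  shows "dirichlet_inner \<alpha> g f = cnj (dirichlet_inner \<alpha> f g)"
proof -
  have "(\<lambda>k. cnj (of_real (real (k + 1) powr \<alpha>) * taylor_coeff f k * cnj (taylor_coeff g k)))
      sums cnj (dirichlet_inner \<alpha> f g)"
    unfolding sums_cnj dirichlet_inner_def
    by (rule summable_sums[OF dirichlet_inner_summable[OF assms]])
  from sums_unique[OF this] show ?thesis
    by (simp add: dirichlet_inner_def mult_ac)
qed

lemma dirichlet_inner_self:
  assumes "f \<in> dirichlet_space \<alpha>"
  shows "dirichlet_inner \<alpha> f f = of_real ((dirichlet_norm \<alpha> f)\<^sup>2)"
  unfolding dirichlet_norm_sq[OF assms] dirichlet_inner_def
    suminf_of_real[OF dirichlet_spaceD(2)[OF assms]]
  by (rule arg_cong[of _ _ suminf])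
    (simp add: fun_eq_iff complex_norm_square mult.assoc del: of_real_power)

text \<open>The weight of index 0 is 1 and the constant 1 has no other coefficient. Values at 0 thus
  become inner products, which links the Hilbert space geometry to (2) and (3).\<close>

lemma dirichlet_inner_one:
  "dirichlet_inner \<alpha> f (\<lambda>z. 1) = f 0"
proof -
  have "(\<lambda>k. of_real (real (k + 1) powr \<alpha>) * taylor_coeff f k * cnj (taylor_coeff (\<lambda>z. 1) k))
      = (\<lambda>k. if k = 0 then f 0 else 0)"
    by (auto simp: taylor_coeff_one taylor_coeff_0)
  then show ?thesis
    unfolding dirichlet_inner_def using sums_unique[OF sums_single[of 0 "\<lambda>_. f 0"]] by simp
qed

lemma dirichlet_norm_add_sq:
  assumes "f \<in> dirichlet_space \<alpha>" "g \<in> dirichlet_space \<alpha>"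
  shows "(dirichlet_norm \<alpha> (\<lambda>z. f z + g z))\<^sup>2 =
    (dirichlet_norm \<alpha> f)\<^sup>2 + 2 * Re (dirichlet_inner \<alpha> f g) + (dirichlet_norm \<alpha> g)\<^sup>2"
proof -
  note fg = dirichlet_space_add(1)[OF assms]
  have "dirichlet_inner \<alpha> (\<lambda>z. f z + g z) (\<lambda>z. f z + g z)
      = cnj (dirichlet_inner \<alpha> (\<lambda>z. f z + g z) f) + cnj (dirichlet_inner \<alpha> (\<lambda>z. f z + g z) g)"
    unfolding dirichlet_inner_cnj[OF fg assms(1), symmetric]
      dirichlet_inner_cnj[OF fg assms(2), symmetric]
    by (rule dirichlet_inner_add_left[OF assms fg])
  also have "\<dots> = dirichlet_inner \<alpha> f f + dirichlet_inner \<alpha> f g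
      + cnj (dirichlet_inner \<alpha> f g) + dirichlet_inner \<alpha> g g"
    unfolding dirichlet_inner_add_left[OF assms assms(1)] dirichlet_inner_add_left[OF assms assms(2)]
      complex_cnj_add dirichlet_inner_cnj[OF assms(1,1), symmetric]
      dirichlet_inner_cnj[OF assms(2,2), symmetric] dirichlet_inner_cnj[OF assms(2,1), symmetric]
      dirichlet_inner_cnj[OF assms, symmetric]
    by simp
  finally have "Re (dirichlet_inner \<alpha> (\<lambda>z. f z + g z) (\<lambda>z. f z + g z)) = Re \<dots>"
    by (rule arg_cong)
  then show ?thesis
    using assms fg by (simp add: dirichlet_inner_self)
qed

section \<open>Finite orthonormal systems\<close>

lemma dirichlet_space_sum:
  assumes "finite A" "\<And>k. k \<in> A \<Longrightarrow> e k \<in> dirichlet_space \<alpha>"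
  shows "(\<lambda>z. \<Sum>k\<in>A. b k * e k z) \<in> dirichlet_space \<alpha>"
  using assms
proof (induction A rule: finite_induct)
  case empty
  show ?case using dirichlet_space_poly[of 0 \<alpha>] by (simp add: poly_0[abs_def])
next
  case (insert x A)
  then show ?case
    using dirichlet_space_add(1)[OF dirichlet_space_cmult(1), of "e x" \<alpha> _ "b x"] by simp
qed

lemma dirichlet_inner_sum_left:
  assumes "finite A" "\<And>k. k \<in> A \<Longrightarrow> e k \<in> dirichlet_space \<alpha>" "h \<in> dirichlet_space \<alpha>"
  shows "dirichlet_inner \<alpha> (\<lambda>z. \<Sum>k\<in>A. b k * e k z) h = (\<Sum>k\<in>A. b k * dirichlet_inner \<alpha> (e k) h)"
  using assms(1,2)
proof (induction A rule: finite_induct)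
  case empty
  show ?case using dirichlet_inner_cmult_left[OF assms(3,3), of 0] by simp
next
  case (insert x A)
  then show ?case
    using dirichlet_inner_add_left[OF dirichlet_space_cmult(1) dirichlet_space_sum assms(3),
        of "e x" A e "b x" b]
    by (simp add: dirichlet_inner_cmult_left assms(3))
qed

text \<open>The square is completed at each index. The coefficients \<open>b\<close> enter only
  through the last sum, so the distance is least exactly when they are the Fourier coefficients of
  \<open>g\<close>, the conjugates of \<open>dirichlet_inner \<alpha> (e k) g\<close>.\<close>

lemma orthonormal_distance_sq:
  assumes "finite A" and e: "\<And>k. k \<in> A \<Longrightarrow> e k \<in> dirichlet_space \<alpha>"
    and orth: "\<And>k j. k \<in> A \<Longrightarrow> j \<in> A \<Longrightarrow> dirichlet_inner \<alpha> (e k) (e j) = (if k = j then 1 else 0)"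
    and g: "g \<in> dirichlet_space \<alpha>"
  shows "(dirichlet_norm \<alpha> (\<lambda>z. (\<Sum>k\<in>A. b k * e k z) - g z))\<^sup>2 =
    (dirichlet_norm \<alpha> g)\<^sup>2 - (\<Sum>k\<in>A. (cmod (dirichlet_inner \<alpha> (e k) g))\<^sup>2)
    + (\<Sum>k\<in>A. (cmod (b k - cnj (dirichlet_inner \<alpha> (e k) g)))\<^sup>2)"
proof -
  let ?s = "\<lambda>z. \<Sum>k\<in>A. b k * e k z"
  let ?c = "\<lambda>k. dirichlet_inner \<alpha> (e k) g"
  have s: "?s \<in> dirichlet_space \<alpha>"
    by (rule dirichlet_space_sum[OF assms(1) e])
  \<comment> \<open>Writing the negative of \<open>g\<close> as a scalar multiple lets
    \<open>dirichlet_norm_add_sq\<close> and the scalar rules handle the difference.\<close>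
  have ng: "(\<lambda>z. - 1 * g z) \<in> dirichlet_space \<alpha>"
    by (rule dirichlet_space_cmult(1)[OF g])
  have "dirichlet_inner \<alpha> ?s ?s = (\<Sum>k\<in>A. b k * dirichlet_inner \<alpha> (e k) ?s)"
    by (rule dirichlet_inner_sum_left[OF assms(1) e s])
  also have "\<dots> = (\<Sum>k\<in>A. b k * cnj (\<Sum>j\<in>A. b j * dirichlet_inner \<alpha> (e j) (e k)))"
    by (intro sum.cong refl)
      (simp add: dirichlet_inner_cnj[OF s e] dirichlet_inner_sum_left[OF assms(1) e e])
  also have "\<dots> = (\<Sum>k\<in>A. b k * cnj (b k))"
    by (intro sum.cong refl) (simp add: orth if_distrib[of "\<lambda>x. _ * x"] sum.delta assms(1) cong: if_cong)
  finally have "dirichlet_inner \<alpha> ?s ?s = of_real (\<Sum>k\<in>A. (cmod (b k))\<^sup>2)"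
    by (simp only: of_real_sum complex_norm_square)
  then have ss: "(dirichlet_norm \<alpha> ?s)\<^sup>2 = (\<Sum>k\<in>A. (cmod (b k))\<^sup>2)"
    unfolding dirichlet_inner_self[OF s] of_real_eq_iff .
  have "dirichlet_inner \<alpha> (\<lambda>z. - 1 * g z) ?s = - 1 * dirichlet_inner \<alpha> g ?s"
    by (rule dirichlet_inner_cmult_left[OF g s])
  then have "dirichlet_inner \<alpha> ?s (\<lambda>z. - 1 * g z) = - dirichlet_inner \<alpha> ?s g"
    unfolding dirichlet_inner_cnj[OF ng s] dirichlet_inner_cnj[OF s g]
    by (metis complex_cnj_cnj complex_cnj_minus mult_minus1)
  then have sg: "Re (dirichlet_inner \<alpha> ?s (\<lambda>z. - 1 * g z)) = - (\<Sum>k\<in>A. Re (b k * ?c k))"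
    by (simp add: dirichlet_inner_sum_left[OF assms(1) e g])
  have "(cmod (b k - cnj (?c k)))\<^sup>2 = (cmod (b k))\<^sup>2 - 2 * Re (b k * ?c k) + (cmod (?c k))\<^sup>2" for k
    unfolding cmod_power2 by (simp add: power2_eq_square algebra_simps)
  then have "(\<Sum>k\<in>A. (cmod (b k - cnj (?c k)))\<^sup>2) =
      (\<Sum>k\<in>A. (cmod (b k))\<^sup>2) - 2 * (\<Sum>k\<in>A. Re (b k * ?c k)) + (\<Sum>k\<in>A. (cmod (?c k))\<^sup>2)"
    by (simp add: sum.distrib sum_subtractf sum_distrib_left del: times_complex.sel)
  then show ?thesis
    using dirichlet_norm_add_sq[OF s ng] dirichlet_space_cmult(2)[OF g, of "- 1"]
    unfolding ss sg by simp
qed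

subsection \<open>Cyclicity\<close>

text \<open>The scalars of a linear combination are gathered into the coefficients of one
  polynomial, so the closed span can be discussed through products
  \<open>poly q z * f z\<close>.\<close>

lemma span_shifts_iff:
  "g \<in> cfun.span (range (\<lambda>k z. z ^ k * f z)) \<longleftrightarrow> (\<exists>q. g = (\<lambda>z. poly q z * f z))"
    (is "g \<in> cfun.span ?S \<longleftrightarrow> _")
proof
  assume "g \<in> cfun.span ?S"
  then show "\<exists>q. g = (\<lambda>z. poly q z * f z)"
  proof (induction rule: cfun.span_induct_alt)
    case base
    show ?case by (rule exI[of _ 0]) (simp add: fun_eq_iff)
  next
    case (step c x y)
    then obtain k q where "x = (\<lambda>z. z ^ k * f z)" "y = (\<lambda>z. poly q z * f z)" by auto
    then show ?case
      by (intro exI[of _ "monom c k + q"]) (simp add: fun_eq_iff fun_scale_def poly_monom algebra_simps)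
  qed
next
  assume "\<exists>q. g = (\<lambda>z. poly q z * f z)"
  then obtain q where g: "g = (\<lambda>z. poly q z * f z)" ..
  \<comment> \<open>The span consists of functions, so its finite sums have to be evaluated
    pointwise.\<close>
  have sum_apply: "(\<Sum>i\<in>A. F i) z = (\<Sum>i\<in>A. F i z)" for A and F :: "nat \<Rightarrow> complex \<Rightarrow> complex" and z
    by (induction A rule: infinite_finite_induct) auto
  have "(\<Sum>i\<le>degree q. fun_scale (coeff q i) (\<lambda>z. z ^ i * f z)) \<in> cfun.span ?S"
    by (intro cfun.span_sum cfun.span_scale cfun.span_base) auto
  also have "(\<Sum>i\<le>degree q. fun_scale (coeff q i) (\<lambda>z. z ^ i * f z)) = g"
    by (simp add: g fun_eq_iff sum_apply fun_scale_def poly_altdef sum_distrib_right mult.assoc)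
  finally show "g \<in> cfun.span ?S" .
qed

text \<open>If \<open>q f\<close> is close to 1, then \<open>r q f\<close> is close to
  \<open>r\<close>, because multiplication by a fixed polynomial \<open>r\<close> is bounded; and
  \<open>r\<close> can be taken close to any given \<open>g\<close>. Approximating the single
  function 1 is therefore enough.\<close>

lemma cyclic_iff_approximates_one:
  assumes f: "f \<in> dirichlet_space \<alpha>"
  shows "cyclic \<alpha> f \<longleftrightarrow> (\<forall>\<epsilon>>0. \<exists>q. dirichlet_norm \<alpha> (\<lambda>z. poly q z * f z - 1) < \<epsilon>)"
proof -
  have closed_span: "dirichlet_closed_span \<alpha> (range (\<lambda>k z. z ^ k * f z)) =
      {g \<in> dirichlet_space \<alpha>. \<forall>\<epsilon>>0. \<exists>q. dirichlet_norm \<alpha> (\<lambda>z. g z - poly q z * f z) < \<epsilon>}"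
    unfolding dirichlet_closed_span_def Bex_def span_shifts_iff by blast
  note qf = dirichlet_space_poly_mult[OF f]
  show ?thesis
  proof
    assume "cyclic \<alpha> f"
    then have "(\<lambda>z. 1) \<in> dirichlet_closed_span \<alpha> (range (\<lambda>k z. z ^ k * f z))"
      by (simp add: cyclic_def dirichlet_space_one)
    then show "\<forall>\<epsilon>>0. \<exists>q. dirichlet_norm \<alpha> (\<lambda>z. poly q z * f z - 1) < \<epsilon>"
      unfolding closed_span dirichlet_norm_minus_commute[OF qf dirichlet_space_one]
      by simp
  next
    assume approx: "\<forall>\<epsilon>>0. \<exists>q. dirichlet_norm \<alpha> (\<lambda>z. poly q z * f z - 1) < \<epsilon>"
    have "\<exists>q. dirichlet_norm \<alpha> (\<lambda>z. g z - poly q z * f z) < \<epsilon>"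
      if g: "g \<in> dirichlet_space \<alpha>" and "\<epsilon> > 0" for g \<epsilon>
    proof -
      \<comment> \<open>In the split \<open>g - r q f = (g - r) + (- r) (q f - 1)\<close> each
        summand gets the budget \<open>\<epsilon>\<^sup>2 / 4\<close>, since the squared norm of a
        sum is at most twice the sum of the squared norms.\<close>
      obtain r where r: "(dirichlet_norm \<alpha> (\<lambda>z. g z - poly r z))\<^sup>2 < \<epsilon>\<^sup>2 / 4"
        by (rule polynomials_dense[OF g, of "\<epsilon>\<^sup>2 / 4"]) (use \<open>\<epsilon> > 0\<close> in auto)
      obtain C where C: "C > 0" "\<And>h. h \<in> dirichlet_space \<alpha> \<Longrightarrow>
          (dirichlet_norm \<alpha> (\<lambda>z. poly (- r) z * h z))\<^sup>2 \<le> C * (dirichlet_norm \<alpha> h)\<^sup>2"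
        using poly_multiplication_bounded[of \<alpha> "- r"] by blast
      \<comment> \<open>The tolerance for \<open>q\<close> depends on \<open>r\<close> through
        \<open>C\<close>: its square times \<open>C\<close> is exactly
        \<open>\<epsilon>\<^sup>2 / 4\<close>.\<close>
      have "sqrt (\<epsilon>\<^sup>2 / (4 * C)) > 0"
        using \<open>\<epsilon> > 0\<close> C(1) by simp
      then obtain q where q: "dirichlet_norm \<alpha> (\<lambda>z. poly q z * f z - 1) < sqrt (\<epsilon>\<^sup>2 / (4 * C))"
        using approx by blast
      let ?h = "\<lambda>z. poly q z * f z - 1"
      have h: "?h \<in> dirichlet_space \<alpha>"
        by (rule dirichlet_space_diff[OF qf dirichlet_space_one])
      have "(dirichlet_norm \<alpha> ?h)\<^sup>2 < (sqrt (\<epsilon>\<^sup>2 / (4 * C)))\<^sup>2"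
        by (rule power_strict_mono[OF q dirichlet_norm_nonneg[OF h]]) simp
      also have "\<dots> = \<epsilon>\<^sup>2 / (4 * C)"
        using C(1) by simp
      finally have "C * (dirichlet_norm \<alpha> ?h)\<^sup>2 < \<epsilon>\<^sup>2 / 4"
        using C(1) by (simp add: field_simps)
      with C(2)[OF h] have rh: "(dirichlet_norm \<alpha> (\<lambda>z. poly (- r) z * ?h z))\<^sup>2 < \<epsilon>\<^sup>2 / 4"
        by linarith
      have "(dirichlet_norm \<alpha> (\<lambda>z. g z - poly (r * q) z * f z))\<^sup>2 =
          (dirichlet_norm \<alpha> (\<lambda>z. (g z - poly r z) + poly (- r) z * ?h z))\<^sup>2"
        by (simp add: algebra_simps)
      also have "\<dots> \<le> 2 * (dirichlet_norm \<alpha> (\<lambda>z. g z - poly r z))\<^sup>2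
          + 2 * (dirichlet_norm \<alpha> (\<lambda>z. poly (- r) z * ?h z))\<^sup>2"
        by (intro dirichlet_space_add dirichlet_space_diff[OF g dirichlet_space_poly]
            dirichlet_space_poly_mult h)
      also have "\<dots> < \<epsilon>\<^sup>2"
        using r rh by linarith
      finally have "dirichlet_norm \<alpha> (\<lambda>z. g z - poly (r * q) z * f z) < \<epsilon>"
        using \<open>\<epsilon> > 0\<close> by (simp add: power_less_imp_less_base)
      then show ?thesis by blast
    qed
    then show "cyclic \<alpha> f"
      unfolding cyclic_def closed_span using f by auto
  qed
qed

section \<open>Optimal approximants in terms of orthogonal polynomials\<close>

lemma graded_basis_expansion:
  fixes \<phi> :: "nat \<Rightarrow> 'a::field poly"
  assumes "\<And>k. degree (\<phi> k) = k" "\<And>k. \<phi> k \<noteq> 0" "degree q \<le> n"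
  obtains b where "q = (\<Sum>k\<le>n. smult (b k) (\<phi> k))"
proof -
  \<comment> \<open>Subtracting a multiple of \<open>\<phi> m\<close> kills the coefficient of index
    m and, by degree, keeps the higher ones zero. Measuring \<open>q\<close> by vanishing
    coefficients rather than by degree lets the induction start at q = 0 with the empty sum.\<close>
  have "\<exists>b. q = (\<Sum>k<m. smult (b k) (\<phi> k))" if "\<forall>i\<ge>m. coeff q i = 0" for m
    using that
  proof (induction m arbitrary: q)
    case 0
    then show ?case by (auto simp: poly_eq_iff)
  next
    case (Suc m)
    define c where "c = coeff q m / lead_coeff (\<phi> m)"
    have "coeff (q - smult c (\<phi> m)) i = 0" if "i \<ge> m" for i
    proof (cases "i = m")
      case True
      then show ?thesis using assms(1,2)[of m] leading_coeff_neq_0[of "\<phi> m"] by (simp add: c_def)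
    next
      case False
      then show ?thesis using that Suc.prems assms(1)[of m] by (simp add: coeff_eq_0)
    qed
    then obtain b where b: "q - smult c (\<phi> m) = (\<Sum>k<m. smult (b k) (\<phi> k))"
      using Suc.IH by blast
    have "q = (\<Sum>k<Suc m. smult ((b(m := c)) k) (\<phi> k))"
      using b by (simp add: algebra_simps)
    then show ?case by blast
  qed
  from this[of "Suc n"] show ?thesis
    using that assms(3) by (auto simp: coeff_eq_0 lessThan_Suc_atMost)
qed

text \<open>Comparison with the polynomial built from the Fourier coefficients of 1 identifies
  \<open>p\<close>. Its value at 0 and its distance are then governed by the same partial
  sum.\<close>

lemma optimal_approximant_orthogonal_polynomials:
  assumes f: "f \<in> dirichlet_space \<alpha>"
    and p: "is_optimal_approximant \<alpha> f n p"
    and \<phi>: "is_orthogonal_polynomials \<alpha> f \<phi>"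
  shows "poly p 0 = cnj (f 0) * of_real (\<Sum>k\<le>n. (cmod (poly (\<phi> k) 0))\<^sup>2)"
    and "(dirichlet_norm \<alpha> (\<lambda>z. poly p z * f z - 1))\<^sup>2 =
      1 - (cmod (f 0))\<^sup>2 * (\<Sum>k\<le>n. (cmod (poly (\<phi> k) 0))\<^sup>2)"
proof -
  define c where "c k = poly (\<phi> k) 0 * f 0" for k
  have deg: "degree (\<phi> k) = k" and "\<phi> k \<noteq> 0" for k
    using \<phi> by (auto simp: is_orthogonal_polynomials_def dest: spec[of _ k])
  then obtain b where b: "p = (\<Sum>k\<le>n. smult (b k) (\<phi> k))"
    using p graded_basis_expansion[of \<phi> p n] by (auto simp: is_optimal_approximant_def)
  \<comment> \<open>Stated for arbitrary coefficients, as it serves both \<open>p\<close> and the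
    competitor \<open>q\<close>. Here \<open>c k\<close> is the inner product of
    \<open>\<phi> k\<close> times \<open>f\<close> with 1.\<close>
  have dist: "(dirichlet_norm \<alpha> (\<lambda>z. poly (\<Sum>k\<le>n. smult (b k) (\<phi> k)) z * f z - 1))\<^sup>2 =
      1 - (\<Sum>k\<le>n. (cmod (c k))\<^sup>2) + (\<Sum>k\<le>n. (cmod (b k - cnj (c k)))\<^sup>2)" for b
  proof -
    have "(dirichlet_norm \<alpha> (\<lambda>z. (\<Sum>k\<le>n. b k * (poly (\<phi> k) z * f z)) - 1))\<^sup>2 =
      1 - (\<Sum>k\<le>n. (cmod (c k))\<^sup>2) + (\<Sum>k\<le>n. (cmod (b k - cnj (c k)))\<^sup>2)"
      by (subst orthonormal_distance_sq)
        (use \<phi> in \<open>auto simp: dirichlet_space_poly_mult f is_orthogonal_polynomials_def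
           weighted_inner_def dirichlet_space_one dirichlet_norm_one dirichlet_inner_one c_def\<close>)
    then show ?thesis
      by (simp add: poly_sum sum_distrib_right mult.assoc)
  qed
  \<comment> \<open>With these coefficients the last sum in \<open>dist\<close> vanishes.\<close>
  define q where "q = (\<Sum>k\<le>n. smult (cnj (c k)) (\<phi> k))"
  have "degree q \<le> n"
    unfolding q_def by (intro degree_sum_le) (auto simp: deg intro: order_trans[OF degree_smult_le])
  then have "dirichlet_norm \<alpha> (\<lambda>z. poly p z * f z - 1) \<le> dirichlet_norm \<alpha> (\<lambda>z. poly q z * f z - 1)"
    using p by (auto simp: is_optimal_approximant_def)
  then have "(dirichlet_norm \<alpha> (\<lambda>z. poly p z * f z - 1))\<^sup>2 \<le> (dirichlet_norm \<alpha> (\<lambda>z. poly q z * f z - 1))\<^sup>2"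
    by (intro power_mono dirichlet_norm_nonneg dirichlet_space_diff dirichlet_space_poly_mult f
        dirichlet_space_one)
  \<comment> \<open>The terms common to both distances cancel; only the deviation of
    \<open>b\<close> from the Fourier coefficients remains.\<close>
  then have "(\<Sum>k\<le>n. (cmod (b k - cnj (c k)))\<^sup>2) \<le> 0"
    unfolding b q_def dist by simp
  then have "(\<Sum>k\<le>n. (cmod (b k - cnj (c k)))\<^sup>2) = 0"
    by (intro antisym sum_nonneg) auto
  then have "b k = cnj (c k)" if "k \<le> n" for k
    using that by (subst (asm) sum_nonneg_eq_0_iff) auto
  then have pq: "p = q"
    unfolding b q_def by (intro sum.cong) auto
  have "poly p 0 = (\<Sum>k\<le>n. cnj (f 0) * of_real ((cmod (poly (\<phi> k) 0))\<^sup>2))"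
    unfolding pq q_def poly_sum c_def
    by (intro sum.cong refl) (simp add: complex_norm_square mult_ac del: of_real_power)
  then show "poly p 0 = cnj (f 0) * of_real (\<Sum>k\<le>n. (cmod (poly (\<phi> k) 0))\<^sup>2)"
    by (simp add: sum_distrib_left)
  show "(dirichlet_norm \<alpha> (\<lambda>z. poly p z * f z - 1))\<^sup>2 =
      1 - (cmod (f 0))\<^sup>2 * (\<Sum>k\<le>n. (cmod (poly (\<phi> k) 0))\<^sup>2)"
    unfolding pq q_def dist
    by (simp add: c_def norm_mult power_mult_distrib sum_distrib_left mult_ac)
qed

section \<open>Equivalence of the three conditions\<close>

theorem theorem5p1:
  fixes \<alpha> :: real and f :: "complex \<Rightarrow> complex"
    and p :: "nat \<Rightarrow> complex poly" and \<phi> :: "nat \<Rightarrow> complex poly"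
  assumes "f \<in> dirichlet_space \<alpha>"
    and "f 0 \<noteq> 0"
    and "\<And>n. is_optimal_approximant \<alpha> f n (p n)"
    and "is_orthogonal_polynomials \<alpha> f \<phi>"
  shows "(cyclic \<alpha> f \<longleftrightarrow> (\<lambda>n. poly (p n) 0) \<longlonglongrightarrow> 1 / f 0) \<and>
         ((\<lambda>n. poly (p n) 0) \<longlonglongrightarrow> 1 / f 0 \<longleftrightarrow>
            (\<lambda>k. (cmod (poly (\<phi> k) 0))\<^sup>2) sums (1 / (cmod (f 0))\<^sup>2))"
proof -
  define S where "S n = (\<Sum>k\<le>n. (cmod (poly (\<phi> k) 0))\<^sup>2)" for n
  define d where "d n = dirichlet_norm \<alpha> (\<lambda>z. poly (p n) z * f z - 1)" for n
  note opt = optimal_approximant_orthogonal_polynomials[OF assms(1,3,4), folded S_def d_def]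
  have d_nonneg: "d n \<ge> 0" for n
    unfolding d_def
    by (intro dirichlet_norm_nonneg dirichlet_space_diff dirichlet_space_poly_mult assms(1)
        dirichlet_space_one)
  \<comment> \<open>\<open>S n\<close> includes the index n, to match order n of the approximant,
    hence the form of \<open>sums\<close> with closed initial segments.\<close>
  have sums_iff: "(\<lambda>k. (cmod (poly (\<phi> k) 0))\<^sup>2) sums (1 / (cmod (f 0))\<^sup>2) \<longleftrightarrow> S \<longlonglongrightarrow> 1 / (cmod (f 0))\<^sup>2"
    unfolding sums_def_le S_def ..
  \<comment> \<open>Both \<open>poly (p n) 0\<close> and its claimed limit carry the nonzero factor
    \<open>cnj (f 0)\<close>; cancelling it leaves a limit of real numbers.\<close>
  have "1 / f 0 = cnj (f 0) * of_real (1 / (cmod (f 0))\<^sup>2)"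
    using assms(2) by (simp add: complex_norm_square field_simps del: of_real_power)
  then have "(\<lambda>n. poly (p n) 0) \<longlonglongrightarrow> 1 / f 0 \<longleftrightarrow>
      (\<lambda>n. cnj (f 0) * of_real (S n)) \<longlonglongrightarrow> cnj (f 0) * of_real (1 / (cmod (f 0))\<^sup>2)"
    by (simp only: opt(1))
  also have "\<dots> \<longleftrightarrow> S \<longlonglongrightarrow> 1 / (cmod (f 0))\<^sup>2"
    using assms(2) by (subst tendsto_mult_left_iff) (auto simp only: complex_cnj_zero_iff tendsto_of_real_iff)
  finally have p_iff: "(\<lambda>n. poly (p n) 0) \<longlonglongrightarrow> 1 / f 0 \<longleftrightarrow> S \<longlonglongrightarrow> 1 / (cmod (f 0))\<^sup>2" .
  have S_eq: "S n = (1 - (d n)\<^sup>2) / (cmod (f 0))\<^sup>2" for n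
    using opt(2)[of n] assms(2) by (simp add: field_simps)
  have S_iff: "S \<longlonglongrightarrow> 1 / (cmod (f 0))\<^sup>2 \<longleftrightarrow> d \<longlonglongrightarrow> 0"
  proof
    assume "d \<longlonglongrightarrow> 0"
    then have "(\<lambda>n. (1 - (d n)\<^sup>2) / (cmod (f 0))\<^sup>2) \<longlonglongrightarrow> (1 - 0\<^sup>2) / (cmod (f 0))\<^sup>2"
      by (intro tendsto_intros) (use assms(2) in auto)
    then show "S \<longlonglongrightarrow> 1 / (cmod (f 0))\<^sup>2"
      by (simp add: S_eq[abs_def])
  next
    assume "S \<longlonglongrightarrow> 1 / (cmod (f 0))\<^sup>2"
    \<comment> \<open>By the distance formula the radicand is the square of \<open>d n\<close>, and
      \<open>d n\<close> is nonnegative, so the root recovers \<open>d n\<close> itself.\<close>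
    then have "(\<lambda>n. sqrt (1 - (cmod (f 0))\<^sup>2 * S n)) \<longlonglongrightarrow> sqrt (1 - (cmod (f 0))\<^sup>2 * (1 / (cmod (f 0))\<^sup>2))"
      by (intro tendsto_intros)
    then show "d \<longlonglongrightarrow> 0"
      using assms(2) d_nonneg by (simp flip: opt(2))
  qed
  have "cyclic \<alpha> f \<longleftrightarrow> d \<longlonglongrightarrow> 0"
    unfolding cyclic_iff_approximates_one[OF assms(1)]
  proof
    assume approx: "\<forall>\<epsilon>>0. \<exists>q. dirichlet_norm \<alpha> (\<lambda>z. poly q z * f z - 1) < \<epsilon>"
    show "d \<longlonglongrightarrow> 0"
    proof (rule LIMSEQ_I)
      fix r :: real assume "r > 0"
      then obtain q where q: "dirichlet_norm \<alpha> (\<lambda>z. poly q z * f z - 1) < r"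
        using approx by blast
      \<comment> \<open>A single good \<open>q\<close> competes at every order n from its degree on,
        so minimality bounds all later distances at once.\<close>
      have "d n < r" if "n \<ge> degree q" for n
        using assms(3)[of n] that q unfolding is_optimal_approximant_def d_def
        by (blast intro: le_less_trans)
      then show "\<exists>no. \<forall>n\<ge>no. norm (d n - 0) < r"
        using d_nonneg by (intro exI[of _ "degree q"]) auto
    qed
  next
    assume lim: "d \<longlonglongrightarrow> 0"
    show "\<forall>\<epsilon>>0. \<exists>q. dirichlet_norm \<alpha> (\<lambda>z. poly q z * f z - 1) < \<epsilon>"
    proof (intro allI impI)
      fix \<epsilon> :: real assume "\<epsilon> > 0"
      \<comment> \<open>Conversely, an optimal approximant of large order is itself the required
        polynomial.\<close>
      from order_tendstoD(2)[OF lim this] obtain n where "d n < \<epsilon>"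
        by (auto simp: eventually_sequentially)
      then show "\<exists>q. dirichlet_norm \<alpha> (\<lambda>z. poly q z * f z - 1) < \<epsilon>"
        unfolding d_def by blast
    qed
  qed
  with p_iff S_iff sums_iff show ?thesis by blast
qed

end
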